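(* Let $q\geq 2$ be a prime power and let $L$ be a non-abelian finite-dimensional Lie algebra over the finite field $\mathbb{F}_q$ such that $d(L)\in \left[\frac{1}{q}, \frac{q^{2}+q-1}{q^{3}}\right]$. Then $d(L)$ is one of the terms of the sequence $\left\lbrace \frac{q^{2n}+q-1}{q^{2n+1}} \right\rbrace_{n=1}^{\infty}$.
   Context: For a finite-dimensional Lie algebra $L$ over $\mathbb{F}_q$, the commutativity degree is $d(L)=\dfrac{|\{(x,y)\in L\times L : [x,y]=0\}|}{|L|^2}$. *)

theory Defs
  imports Complex_Main "HOL-Number_Theory.Prime_Powers"
begin

locale lie_algebra = vector_space scale
  for scale :: "'k::field \<Rightarrow> 'v::ab_group_add \<Rightarrow> 'v" +
  fixes bracket :: "'v \<Rightarrow> 'v \<Rightarrow> 'v"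
  assumes linear_bracket_left: "Vector_Spaces.linear scale scale (\<lambda>x. bracket x y)"
    and linear_bracket_right: "Vector_Spaces.linear scale scale (\<lambda>y. bracket x y)"
    \<comment> \<open>alternating, not merely antisymmetric: the two differ in characteristic 2\<close>
    and bracket_self: "bracket x x = 0"
    and jacobi: "bracket x (bracket y z) + bracket y (bracket z x) + bracket z (bracket x y) = 0"

definition abelian_bracket :: "('v \<Rightarrow> 'v \<Rightarrow> 'v::zero) \<Rightarrow> bool" where
  "abelian_bracket bracket \<longleftrightarrow> (\<forall>x y. bracket x y = 0)"

text \<open>The algebra is the whole type, so its order is the cardinality of the type; the definition
  is meaningful only when the type is finite.\<close>

definition commutativity_degree :: "('v \<Rightarrow> 'v \<Rightarrow> 'v::zero) \<Rightarrow> real" where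
  "commutativity_degree bracket =
     real (card {(x, y). bracket x y = 0}) / real (card (UNIV :: 'v set)) ^ 2"

end

theory Submission
  imports Defs "HOL-Library.Product_Plus"
begin

text \<open>
  The argument is about alternating bilinear maps. Call the proportion of pairs on which such a
  map vanishes its zero density; the commutativity degree is the zero density of the bracket.

  For a nonzero alternating \<^emph>\<open>form\<close> on a finite space \<open>V\<close> over a field with \<open>q\<close> elements, splitting
  off hyperbolic planes shows that the radical has index \<open>q\<^sup>2\<^sup>n\<close> with \<open>n \<ge> 1\<close>. A vector in the
  radical is orthogonal to all of \<open>V\<close>, any other vector to exactly one \<open>q\<close>-th of \<open>V\<close>, so
  the zero density is \<open>(q\<^sup>2\<^sup>n + q - 1) / q\<^sup>2\<^sup>n\<^sup>+\<^sup>1\<close> (lemma \<open>zero_density_eq\<close>). In particular it never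
  exceeds the value \<open>(q\<^sup>2 + q - 1) / q\<^sup>3\<close> at \<open>n = 1\<close>.

  If all brackets are multiples of one vector, the bracket is essentially such a form, and its
  degree is a term of the sequence. Otherwise two brackets are linearly independent and are separated
  by functionals \<open>f\<close> and \<open>g\<close>, so that every nontrivial combination \<open>a f + b g\<close> turns the bracket
  into a nonzero alternating form. Averaging the zero densities of these forms over all \<open>(a, b)\<close>
  bounds the degree by \<open>(2 q\<^sup>2 - 1) / q\<^sup>4\<close>, which is less than \<open>1 / q\<close> (lemma
  \<open>zero_density_less_of_independent_forms\<close>). So only the first case meets the interval.
\<close>

definition zero_density :: "('v \<Rightarrow> 'v \<Rightarrow> 'w::zero) \<Rightarrow> real" where
  "zero_density b = real (card {(x, y). b x y = 0}) / real (card (UNIV :: 'v set)) ^ 2"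

section \<open>Linear functionals over a finite field\<close>

text \<open>If \<open>\<phi> v = 1\<close>, the space is the direct sum of the line through \<open>v\<close> and the kernel.\<close>

lemma card_eq_times_card_kernel:
  fixes scale :: "'k::{field,finite} \<Rightarrow> 'v::ab_group_add \<Rightarrow> 'v" and \<phi> :: "'v \<Rightarrow> 'k"
  assumes "Vector_Spaces.linear scale (*) \<phi>" and "\<phi> v \<noteq> 0"
  shows "card (UNIV :: 'v set) = card (UNIV :: 'k set) * card {x. \<phi> x = 0}"
proof -
  interpret Vector_Spaces.linear scale "(*)" \<phi> by fact
  let ?K = "{x. \<phi> x = 0}"
  define u where "u = scale (1 / \<phi> v) v"
  have u: "\<phi> u = 1"
    using assms(2) by (simp add: u_def scale)
  have "bij_betw (\<lambda>(a, w). scale a u + w) (UNIV \<times> ?K) (UNIV :: 'v set)"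
  proof (rule bij_betw_byWitness[where f' = "\<lambda>x. (\<phi> x, x - scale (\<phi> x) u)"])
  qed (auto simp: add diff scale u)
  from bij_betw_same_card[OF this] show ?thesis
    by (simp add: card_cartesian_product)
qed

lemma vector_space_field: "vector_space ((*) :: 'k::field \<Rightarrow> 'k \<Rightarrow> 'k)"
  by unfold_locales (auto simp: algebra_simps)

context vector_space
begin

lemma ex_functional_eq_one:
  assumes "c \<noteq> 0"
  obtains f where "Vector_Spaces.linear scale (*) f" and "f c = 1"
proof -
  interpret vector_space_pair scale "(*)"
    using vector_space_axioms vector_space_field by (rule vector_space_pair.intro)
  have "independent {c}"
    using assms by simp
  from linear_independent_extend[OF this, of "\<lambda>_. 1"] show ?thesis
    using that by auto
qed

text \<open>Two applications, with the roles of \<open>c\<close> and \<open>d\<close> exchanged, give a dual pair.\<close>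

lemma ex_functional_eq_one_zero:
  assumes "independent {c, d}" and "c \<noteq> d"
  obtains f where "Vector_Spaces.linear scale (*) f" and "f c = 1" and "f d = 0"
proof -
  interpret vector_space_pair scale "(*)"
    using vector_space_axioms vector_space_field by (rule vector_space_pair.intro)
  from linear_independent_extend[OF assms(1), of "\<lambda>x. if x = c then 1 else 0"] show ?thesis
    using that assms(2) by auto
qed

end

lemma finite_UNIV_of_finite_dimensional:
  fixes scale :: "'k::{field,finite} \<Rightarrow> 'v::ab_group_add \<Rightarrow> 'v"
  assumes "finite_dimensional_vector_space scale B"
  shows "finite (UNIV :: 'v set)"
proof -
  interpret finite_dimensional_vector_space scale B by fact
  have "finite (span A)" if "finite A" for A
    using that
  proof induction
    case (insert a A)
    have "span (insert a A) \<subseteq> (\<lambda>(k, z). scale k a + z) ` (UNIV \<times> span A)"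
      unfolding span_insert by (force simp: image_iff)
    then show ?case
      by (rule finite_subset) (use insert in auto)
  qed simp
  from this[OF finite_Basis] show ?thesis
    by (simp add: span_Basis)
qed

section \<open>Zeros of an alternating form\<close>

locale alternating_form = vector_space scale
  for scale :: "'k::{field,finite} \<Rightarrow> 'v::ab_group_add \<Rightarrow> 'v" +
  fixes form :: "'v \<Rightarrow> 'v \<Rightarrow> 'k"
  assumes linear_left: "Vector_Spaces.linear scale (*) (\<lambda>x. form x y)"
    and linear_right: "Vector_Spaces.linear scale (*) (\<lambda>y. form x y)"
    and form_self: "form x x = 0"
begin

lemma form_simps:
  shows "form (x + x') y = form x y + form x' y" and "form (x - x') y = form x y - form x' y"
    and "form (scale a x) y = a * form x y" and "form 0 y = 0"
    and "form x (y + y') = form x y + form x y'" and "form x (y - y') = form x y - form x y'"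
    and "form x (scale a y) = a * form x y" and "form x 0 = 0"
proof -
  interpret l: Vector_Spaces.linear scale "(*)" "\<lambda>x. form x y" by (rule linear_left)
  interpret r: Vector_Spaces.linear scale "(*)" "\<lambda>y. form x y" by (rule linear_right)
  show "form (x + x') y = form x y + form x' y" "form (x - x') y = form x y - form x' y"
    "form (scale a x) y = a * form x y" "form 0 y = 0"
    "form x (y + y') = form x y + form x y'" "form x (y - y') = form x y - form x y'"
    "form x (scale a y) = a * form x y" "form x 0 = 0"
    by (simp_all add: l.add l.diff l.scale r.add r.diff r.scale)
qed

lemma form_skew: "form y x = - form x y"
proof -
  have "form y x + form x y = form (x + y) (x + y) - form x x - form y y"
    by (simp add: form_simps)
  then show ?thesis
    by (simp add: form_self eq_neg_iff_add_eq_0)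
qed

definition radical :: "'v set \<Rightarrow> 'v set" where
  "radical W = {x \<in> W. \<forall>y\<in>W. form x y = 0}"

text \<open>\<open>W\<close> is the orthogonal sum of the hyperbolic plane spanned by \<open>u\<close> and \<open>v\<close> and the orthogonal
  complement of that plane.\<close>

lemma split_hyperbolic_plane:
  assumes W: "subspace W" and uv: "u \<in> W" "v \<in> W" "form u v = 1"
  defines "W' \<equiv> {w \<in> W. form u w = 0 \<and> form v w = 0}"
  shows "subspace W'" and "card W = card (UNIV :: 'k set) ^ 2 * card W'"
    and "radical W' = radical W"
proof -
  have vu: "form v u = -1"
    using form_skew[of v u] uv by simp
  note closed = subspace_add[OF W] subspace_diff[OF W] subspace_scale[OF W] subspace_0[OF W]
  show "subspace W'"
    by (rule subspaceI) (auto simp: W'_def form_simps closed)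
  \<comment> \<open>The coordinates of \<open>w\<close> along \<open>u\<close> and \<open>v\<close> are read off by pairing with \<open>v\<close> and \<open>u\<close>.\<close>
  define proj where "proj w = w + scale (form v w) u - scale (form u w) v" for w
  have proj: "proj w \<in> W'" if "w \<in> W" for w
    using that uv vu by (auto simp: W'_def proj_def form_simps form_self closed)
  have "bij_betw (\<lambda>((a, b), w). scale a u + scale b v + w) ((UNIV \<times> UNIV) \<times> W') W"
  proof (rule bij_betw_byWitness[where f' = "\<lambda>w. ((- form v w, form u w), proj w)"])
    show "\<forall>p\<in>(UNIV \<times> UNIV) \<times> W'. (\<lambda>w. ((- form v w, form u w), proj w))
        ((\<lambda>((a, b), w). scale a u + scale b v + w) p) = p"
      using uv vu by (auto simp: W'_def proj_def form_simps form_self algebra_simps)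
    show "\<forall>w\<in>W. (\<lambda>((a, b), w). scale a u + scale b v + w)
        ((- form v w, form u w), proj w) = w"
      by (auto simp: proj_def algebra_simps)
    show "(\<lambda>((a, b), w). scale a u + scale b v + w) ` ((UNIV \<times> UNIV) \<times> W') \<subseteq> W"
      using uv by (auto simp: W'_def closed)
    show "(\<lambda>w. ((- form v w, form u w), proj w)) ` W \<subseteq> (UNIV \<times> UNIV) \<times> W'"
      using proj by auto
  qed
  from bij_betw_same_card[OF this] show "card W = card (UNIV :: 'k set) ^ 2 * card W'"
    by (simp add: card_cartesian_product power2_eq_square del: UNIV_Times_UNIV)
  show "radical W' = radical W"
  proof (intro equalityI subsetI)
    fix x assume x: "x \<in> radical W'"
    have ux: "form x u = 0" "form x v = 0"
      using x form_skew[of x u] form_skew[of x v] by (auto simp: radical_def W'_def)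
    have "form x w = 0" if "w \<in> W" for w
    proof -
      have "form x (proj w) = 0"
        using x proj[OF that] by (auto simp: radical_def)
      then show ?thesis
        using ux by (simp add: proj_def form_simps)
    qed
    then show "x \<in> radical W"
      using x by (auto simp: radical_def W'_def)
  next
    fix x assume x: "x \<in> radical W"
    then have "form u x = 0" "form v x = 0"
      using uv form_skew[of u x] form_skew[of v x] by (auto simp: radical_def)
    then show "x \<in> radical W'"
      using x by (auto simp: radical_def W'_def)
  qed
qed

text \<open>Alternating forms have even rank.\<close>

lemma card_eq_even_power_times_card_radical:
  assumes "subspace W" and "finite W"
  shows "\<exists>n. card W = card (UNIV :: 'k set) ^ (2 * n) * card (radical W)"
  using assms
proof (induction "card W" arbitrary: W rule: less_induct)
  case less
  show ?case
  proof (cases "\<forall>x\<in>W. \<forall>y\<in>W. form x y = 0")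
    case True
    then have "radical W = W"
      by (auto simp: radical_def)
    then show ?thesis
      by (intro exI[of _ 0]) simp
  next
    case False
    then obtain x y where xy: "x \<in> W" "y \<in> W" "form x y \<noteq> 0"
      by blast
    define u where "u = scale (1 / form x y) x"
    have u: "u \<in> W" "form u y = 1"
      using xy less.prems by (auto simp: u_def subspace_scale form_simps)
    define W' where "W' = {w \<in> W. form u w = 0 \<and> form y w = 0}"
    note split = split_hyperbolic_plane[OF less.prems(1) u(1) xy(2) u(2), folded W'_def]
    have "form y u \<noteq> 0"
      using u(2) form_skew[of y u] by simp
    then have "W' \<subset> W"
      using u(1) by (auto simp: W'_def)
    then have "card W' < card W" and fin: "finite W'"
      using less.prems(2) by (auto intro: psubset_card_mono finite_subset)
    with less.hyps[OF _ split(1)] obtain n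
      where n: "card W' = card (UNIV :: 'k set) ^ (2 * n) * card (radical W')"
      by blast
    have "card W = card (UNIV :: 'k set) ^ (2 * Suc n) * card (radical W)"
      using n split(2,3) by (simp add: power2_eq_square)
    then show ?thesis ..
  qed
qed

text \<open>A row \<open>form x\<close> of the form vanishes everywhere if \<open>x\<close> is in the radical, and otherwise on the
  kernel of a nonzero functional.\<close>

lemma card_zeros:
  assumes fin: "finite (UNIV :: 'v set)"
  shows "card (UNIV :: 'k set) * card {(x, y). form x y = 0} + card (UNIV :: 'v set) * card (radical UNIV)
    = card (UNIV :: 'v set) * (card (UNIV :: 'k set) * card (radical UNIV) + card (UNIV :: 'v set))"
    (is "?q * card ?N + ?m * ?r = _")
proof -
  have row: "?q * card {y. form x y = 0} = (if x \<in> radical UNIV then ?q * ?m else ?m)" for x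
  proof (cases "x \<in> radical UNIV")
    case False
    then obtain y where "form x y \<noteq> 0"
      by (auto simp: radical_def)
    from card_eq_times_card_kernel[OF linear_right this] False show ?thesis
      by simp
  qed (auto simp: radical_def)
  have "?N = Sigma UNIV (\<lambda>x. {y. form x y = 0})"
    by auto
  then have "card ?N = (\<Sum>x\<in>UNIV. card {y. form x y = 0})"
    using fin by (simp add: finite_subset[OF subset_UNIV fin])
  then have "?q * card ?N = (\<Sum>x\<in>UNIV. if x \<in> radical UNIV then ?q * ?m else ?m)"
    by (simp add: sum_distrib_left row)
  also have "\<dots> = ?r * (?q * ?m) + card (- radical UNIV) * ?m"
    using fin by (simp add: sum.If_cases)
  finally have "?q * card ?N = ?r * (?q * ?m) + card (- radical UNIV) * ?m" .
  moreover have "card (- radical UNIV) + ?r = ?m"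
    using card_Un_disjoint[of "- radical UNIV" "radical UNIV"] finite_subset[OF subset_UNIV fin]
    by simp
  then have "card (- radical UNIV) * ?m + ?r * ?m = ?m * ?m"
    by (simp only: add_mult_distrib[symmetric])
  ultimately show ?thesis
    by (simp only: distrib_left mult_ac add_ac)
qed

lemma zero_density_eq:
  assumes fin: "finite (UNIV :: 'v set)" and nz: "form x y \<noteq> 0"
  defines "q \<equiv> real (card (UNIV :: 'k set))"
  shows "\<exists>n\<ge>1. zero_density form = (q ^ (2 * n) + q - 1) / q ^ (2 * n + 1)"
proof -
  define r where "r = real (card (radical UNIV))"
  define m where "m = real (card (UNIV :: 'v set))"
  define N where "N = real (card {(x, y). form x y = 0})"
  have "0 \<in> radical UNIV"
    by (auto simp: radical_def form_simps)
  moreover have "finite (radical UNIV)"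
    using finite_subset[OF subset_UNIV fin] .
  ultimately have r: "r > 0"
    by (auto simp: r_def card_gt_0_iff)
  have q: "q > 0"
    by (simp add: q_def finite_UNIV_card_ge_0)
  obtain n where "card (UNIV :: 'v set) = card (UNIV :: 'k set) ^ (2 * n) * card (radical UNIV)"
    using card_eq_even_power_times_card_radical[OF subspace_UNIV fin] by blast
  moreover have "n \<noteq> 0"
  proof
    assume "n = 0"
    then have "radical UNIV = UNIV"
      using calculation fin by (intro card_subset_eq) auto
    then show False
      using nz by (auto simp: radical_def)
  qed
  ultimately have m: "m = q ^ (2 * n) * r" and n: "n \<ge> 1"
    by (auto simp: m_def q_def r_def)
  have "q * N + m * r = m * (q * r + m)"
    using arg_cong[OF card_zeros[OF fin], of real] by (simp add: q_def N_def m_def r_def)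
  then have "N = m * (q * r + m - r) / q"
    using q by (simp add: field_simps)
  then have "N / m ^ 2 = (q * r + m - r) / (q * m)"
    using q r m by (simp add: power2_eq_square)
  also have "\<dots> = (r * (q ^ (2 * n) + q - 1)) / (r * q ^ (2 * n + 1))"
    by (simp add: m algebra_simps)
  also have "\<dots> = (q ^ (2 * n) + q - 1) / q ^ (2 * n + 1)"
    using r by simp
  finally have "zero_density form = (q ^ (2 * n) + q - 1) / q ^ (2 * n + 1)"
    by (simp add: zero_density_def N_def m_def)
  with n show ?thesis
    by blast
qed

text \<open>The density \<open>1 / q + (1 - 1 / q) / q\<^sup>2\<^sup>n\<close> is largest for rank \<open>2\<close>.\<close>

lemma zero_density_le:
  assumes "finite (UNIV :: 'v set)" and "form x y \<noteq> 0"
  defines "q \<equiv> real (card (UNIV :: 'k set))"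
  shows "zero_density form \<le> (q ^ 2 + q - 1) / q ^ 3"
proof -
  have q: "q \<ge> 1"
    by (simp add: q_def Suc_le_eq finite_UNIV_card_ge_0)
  obtain n where "n \<ge> 1" and n: "zero_density form = (q ^ (2 * n) + q - 1) / q ^ (2 * n + 1)"
    using zero_density_eq[OF assms(1,2)] q_def by blast
  have split: "(q ^ k + q - 1) / q ^ (k + 1) = 1 / q + (q - 1) / q / q ^ k" for k
    using q by (simp add: field_simps)
  have "q ^ 2 \<le> q ^ (2 * n)"
    using \<open>n \<ge> 1\<close> q by (intro power_increasing) auto
  then have "(q - 1) / q / q ^ (2 * n) \<le> (q - 1) / q / q ^ 2"
    using q by (intro divide_left_mono) auto
  then show ?thesis
    using n split[of "2 * n"] split[of 2] by (simp add: numeral_3_eq_3)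
qed

end

section \<open>Two independent forms\<close>

text \<open>For fixed \<open>p\<close> the condition on \<open>(a, b)\<close> is a linear equation over a field with \<open>q\<close> elements: it
  has \<open>q\<close> solutions unless both coefficients \<open>u p\<close> and \<open>w p\<close> are zero, in which case it has \<open>q\<^sup>2\<close>.\<close>

lemma sum_card_zeros_combinations:
  fixes u w :: "'p \<Rightarrow> 'k::{field,finite}"
  assumes fin: "finite A"
  shows "(\<Sum>(a, b)\<in>UNIV. card {p \<in> A. a * u p + b * w p = 0}) + card (UNIV :: 'k set) * card {p \<in> A. u p = 0 \<and> w p = 0}
    = card (UNIV :: 'k set) * card A + card (UNIV :: 'k set) ^ 2 * card {p \<in> A. u p = 0 \<and> w p = 0}"
    (is "?S + ?q * card ?Z = _")
proof -
  have sol: "card {(a, b). a * s + b * t = 0} = (if s = 0 \<and> t = 0 then ?q ^ 2 else ?q)"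
    for s t :: 'k
  proof -
    consider "s = 0" "t = 0" | "s \<noteq> 0" | "t \<noteq> 0"
      by blast
    then show ?thesis
    proof cases
      case 1
      then have "{(a, b). a * s + b * t = 0} = UNIV \<times> UNIV"
        by auto
      then have "card {(a, b). a * s + b * t = 0} = ?q ^ 2"
        by (simp only: card_cartesian_product power2_eq_square)
      with 1 show ?thesis
        by simp
    next
      case 2
      then have "a * s + b * t = 0 \<longleftrightarrow> a = - b * t / s" for a b
        by (simp only: eq_divide_eq mult_minus_left eq_neg_iff_add_eq_0 if_False if_True simp_thms)
      then have "{(a, b). a * s + b * t = 0} = range (\<lambda>b. (- b * t / s, b))"
        by auto
      with 2 show ?thesis
        by (simp add: card_image inj_on_def)
    next
      case 3
      then have "a * s + b * t = 0 \<longleftrightarrow> b = - a * s / t" for a b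
        by (simp only: eq_divide_eq mult_minus_left eq_neg_iff_add_eq_0 if_False if_True simp_thms add.commute)
      then have "{(a, b). a * s + b * t = 0} = range (\<lambda>a. (a, - a * s / t))"
        by auto
      with 3 show ?thesis
        by (simp add: card_image inj_on_def)
    qed
  qed
  have "?S = (\<Sum>c\<in>UNIV. card {p \<in> A. fst c * u p + snd c * w p = 0})"
    by (simp add: case_prod_unfold)
  also have "\<dots> = (\<Sum>p\<in>A. card {c \<in> UNIV. fst c * u p + snd c * w p = 0})"
    using fin by (intro sum_multicount_gen) auto
  also have "\<dots> = (\<Sum>p\<in>A. if u p = 0 \<and> w p = 0 then ?q ^ 2 else ?q)"
    using sol by (simp add: case_prod_unfold)
  also have "\<dots> = ?q ^ 2 * card ?Z + ?q * card (A - ?Z)"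
  proof -
    have "A \<inter> {p. u p = 0 \<and> w p = 0} = ?Z" "A \<inter> - {p. u p = 0 \<and> w p = 0} = A - ?Z"
      by auto
    then show ?thesis
      using fin by (simp only: sum.If_cases sum_constant) (simp add: mult.commute)
  qed
  finally have "?S = ?q ^ 2 * card ?Z + ?q * card (A - ?Z)" .
  moreover have "card (A - ?Z) + card ?Z = card A"
    using fin by (simp add: card_Diff_subset card_mono)
  then have "?q * card (A - ?Z) + ?q * card ?Z = ?q * card A"
    by (simp only: distrib_left[symmetric])
  ultimately show ?thesis
    by linarith
qed

text \<open>The trivial combination contributes all pairs to the preceding count and each of the \<open>q\<^sup>2 - 1\<close>
  others at most the maximal density of an alternating form. This leaves at most \<open>(2 q\<^sup>2 - 1) / q\<^sup>4\<close>
  for the common zeros, and \<open>2 q\<^sup>2 - 1 < q\<^sup>3\<close> for \<open>q \<ge> 2\<close>.\<close>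

lemma zero_density_less_of_independent_forms:
  fixes scale :: "'k::{field,finite} \<Rightarrow> 'v::ab_group_add \<Rightarrow> 'v" and \<beta> \<gamma> :: "'v \<Rightarrow> 'v \<Rightarrow> 'k"
  assumes fin: "finite (UNIV :: 'v set)"
    and alt: "\<And>a b. alternating_form scale (\<lambda>x y. a * \<beta> x y + b * \<gamma> x y)"
    and indep: "\<And>a b. (a, b) \<noteq> (0, 0) \<Longrightarrow> \<exists>x y. a * \<beta> x y + b * \<gamma> x y \<noteq> 0"
  shows "zero_density (\<lambda>x y. (\<beta> x y, \<gamma> x y)) < 1 / real (card (UNIV :: 'k set))"
    (is "?d < 1 / ?q")
proof -
  define q where "q = ?q"
  define M where "M = real (card (UNIV :: 'v set)) ^ 2"
  define \<delta> where "\<delta> = (q ^ 2 + q - 1) / q ^ 3"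
  define S where "S c = {p :: 'v \<times> 'v. fst c * \<beta> (fst p) (snd p) + snd c * \<gamma> (fst p) (snd p) = 0}"
    for c :: "'k \<times> 'k"
  define Z where "Z = real (card {p \<in> UNIV. \<beta> (fst p) (snd p) = 0 \<and> \<gamma> (fst p) (snd p) = 0})"
  have "card {0, 1 :: 'k} \<le> card (UNIV :: 'k set)"
    by (intro card_mono) auto
  then have q: "q \<ge> 2"
    by (simp add: q_def)
  have M: "M > 0"
    using fin by (simp add: M_def finite_UNIV_card_ge_0)
  have card_pairs: "real (card (UNIV :: ('v \<times> 'v) set)) = M"
    by (simp add: M_def card_cartesian_product power2_eq_square flip: UNIV_Times_UNIV)
  have "card (S c) \<le> \<delta> * M" if "c \<noteq> (0, 0)" for c
  proof -
    interpret alternating_form scale "\<lambda>x y. fst c * \<beta> x y + snd c * \<gamma> x y"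
      by (rule alt)
    obtain x y where "fst c * \<beta> x y + snd c * \<gamma> x y \<noteq> 0"
      using indep[of "fst c" "snd c"] \<open>c \<noteq> (0, 0)\<close> by auto
    from zero_density_le[OF fin this] show ?thesis
      using M by (simp add: zero_density_def S_def case_prod_unfold M_def \<delta>_def q_def field_simps)
  qed
  then have "(\<Sum>c\<in>UNIV - {(0, 0)}. real (card (S c))) \<le> real (card (UNIV - {(0 :: 'k, 0 :: 'k)})) * (\<delta> * M)"
    by (intro sum_bounded_above) auto
  also have "real (card (UNIV - {(0 :: 'k, 0 :: 'k)})) = q ^ 2 - 1"
  proof -
    have "card (UNIV :: ('k \<times> 'k) set) = card (UNIV :: 'k set) ^ 2"
      by (simp add: card_cartesian_product power2_eq_square flip: UNIV_Times_UNIV)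
    then show ?thesis
      by (simp add: card_Diff_subset q_def of_nat_diff finite_UNIV_card_ge_0 Suc_le_eq)
  qed
  also have "(\<Sum>c\<in>UNIV - {(0, 0)}. real (card (S c))) = (\<Sum>c\<in>UNIV. real (card (S c))) - M"
    using card_pairs by (simp add: sum_diff1 S_def)
  finally have le: "(\<Sum>c\<in>UNIV. real (card (S c))) \<le> M + (q ^ 2 - 1) * (\<delta> * M)"
    by simp
  have "(\<Sum>c\<in>UNIV. real (card (S c))) + q * Z = q * M + q ^ 2 * Z"
    using arg_cong[OF sum_card_zeros_combinations
        [of "UNIV :: ('v \<times> 'v) set" "\<lambda>p. \<beta> (fst p) (snd p)" "\<lambda>p. \<gamma> (fst p) (snd p)"], of real]
      fin card_pairs
    by (simp add: S_def case_prod_unfold q_def Z_def finite_prod)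
  with le have "(q ^ 2 - q) * Z \<le> M * ((q ^ 2 - 1) * \<delta> - (q - 1))"
    by (simp add: algebra_simps)
  moreover have "Z = ?d * M"
    using M by (simp add: zero_density_def Z_def M_def case_prod_unfold zero_prod_def)
  ultimately have "M * ((q ^ 2 - q) * ?d) \<le> M * ((q ^ 2 - 1) * \<delta> - (q - 1))"
    by (simp add: mult_ac)
  then have "(q ^ 2 - q) * ?d \<le> (q ^ 2 - 1) * \<delta> - (q - 1)"
    using M by simp
  then have "(q - 1) * (q * ?d) \<le> (q - 1) * ((q + 1) * \<delta> - 1)"
    by (simp add: power2_eq_square algebra_simps)
  then have "q * ?d \<le> (q + 1) * \<delta> - 1"
    using q by simp
  also have "(q + 1) * \<delta> < 2"
  proof -
    have "q ^ 2 * q \<ge> q ^ 2 * 2"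
      using q by (intro mult_left_mono) auto
    then have "(q + 1) * (q ^ 2 + q - 1) < 2 * q ^ 3"
      by (simp add: power2_eq_square power3_eq_cube algebra_simps)
    then show ?thesis
      using q by (simp add: \<delta>_def field_simps)
  qed
  finally show ?thesis
    using q by (simp add: q_def[symmetric] field_simps)
qed

section \<open>The commutativity degree\<close>

lemma alternating_form_functional_bracket:
  fixes scale :: "'k::{field,finite} \<Rightarrow> 'v::ab_group_add \<Rightarrow> 'v"
  assumes "lie_algebra scale bracket" and f: "Vector_Spaces.linear scale (*) f"
  shows "alternating_form scale (\<lambda>x y. f (bracket x y))"
proof -
  interpret lie_algebra scale bracket by fact
  interpret f: Vector_Spaces.linear scale "(*)" f by fact
  show ?thesis
    by unfold_locales
      (use Vector_Spaces.linear_compose[OF linear_bracket_left f] Vector_Spaces.linear_compose[OF linear_bracket_right f]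
        in \<open>auto simp: Vector_Spaces.linear_iff bracket_self f.zero\<close>)
qed

theorem corollary2p4:
  fixes q :: nat
    and scale :: "'k::{field,finite} \<Rightarrow> 'v::ab_group_add \<Rightarrow> 'v"
    and bracket :: "'v \<Rightarrow> 'v \<Rightarrow> 'v"
  assumes "q \<ge> 2" and "primepow q"
    and "card (UNIV :: 'k set) = q"
    and "lie_algebra scale bracket"
    and "\<exists>B. finite_dimensional_vector_space scale B"
    and "\<not> abelian_bracket bracket"
    and "commutativity_degree bracket \<in> {1 / real q .. (real q ^ 2 + real q - 1) / real q ^ 3}"
  shows "\<exists>n\<ge>1. commutativity_degree bracket =
           (real q ^ (2 * n) + real q - 1) / real q ^ (2 * n + 1)"
proof -
  interpret lie_algebra scale bracket by fact
  have fin: "finite (UNIV :: 'v set)"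
    using assms(5) finite_UNIV_of_finite_dimensional by blast
  obtain x\<^sub>0 y\<^sub>0 where c: "bracket x\<^sub>0 y\<^sub>0 \<noteq> 0"
    using assms(6) by (auto simp: abelian_bracket_def)
  define c where "c = bracket x\<^sub>0 y\<^sub>0"
  show ?thesis
  proof (cases "\<forall>x y. bracket x y \<in> span {c}")
    case True
    obtain f where f: "Vector_Spaces.linear scale (*) f" "f c = 1"
      using ex_functional_eq_one[of c] c c_def by blast
    interpret f: Vector_Spaces.linear scale "(*)" f by (rule f(1))
    interpret alternating_form scale "\<lambda>x y. f (bracket x y)"
      using assms(4) f(1) by (rule alternating_form_functional_bracket)
    have "f (bracket x y) = 0 \<longleftrightarrow> bracket x y = 0" for x y
    proof -
      obtain k where "bracket x y = scale k c"
        using True by (auto simp: span_singleton)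
      then show ?thesis
        using f(2) c by (simp add: f.scale c_def)
    qed
    then have "commutativity_degree bracket = zero_density (\<lambda>x y. f (bracket x y))"
      by (simp add: commutativity_degree_def zero_density_def)
    moreover have "f (bracket x\<^sub>0 y\<^sub>0) \<noteq> 0"
      using f(2) c_def by simp
    ultimately show ?thesis
      using zero_density_eq[OF fin, of x\<^sub>0 y\<^sub>0] assms(3) by simp
  next
    case False
    then obtain x\<^sub>1 y\<^sub>1 where d: "bracket x\<^sub>1 y\<^sub>1 \<notin> span {c}"
      by blast
    define d where "d = bracket x\<^sub>1 y\<^sub>1"
    have "c \<noteq> d"
      using d span_base by (auto simp: d_def)
    moreover have "independent {d, c}"
      using c d by (intro independent_insertI) (auto simp: c_def d_def independent_empty)
    moreover from this have "independent {c, d}"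
      by (simp add: insert_commute)
    ultimately obtain f g
      where f: "Vector_Spaces.linear scale (*) f" "f c = 1" "f d = 0"
        and g: "Vector_Spaces.linear scale (*) g" "g d = 1" "g c = 0"
      using ex_functional_eq_one_zero[of c d thesis] ex_functional_eq_one_zero[of d c] by metis
    have "zero_density (\<lambda>x y. (f (bracket x y), g (bracket x y))) < 1 / real (card (UNIV :: 'k set))"
    proof (rule zero_density_less_of_independent_forms[OF fin])
      fix a b :: 'k
      have "Vector_Spaces.linear scale (*) (\<lambda>v. a * f v + b * g v)"
        using f(1) g(1) by (auto simp: Vector_Spaces.linear_iff algebra_simps)
      then show "alternating_form scale (\<lambda>x y. a * f (bracket x y) + b * g (bracket x y))"
        using assms(4) alternating_form_functional_bracket by blast
      assume "(a, b) \<noteq> (0, 0)"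
      moreover have "a * f c + b * g c = a" "a * f d + b * g d = b"
        using f g by auto
      ultimately show "\<exists>x y. a * f (bracket x y) + b * g (bracket x y) \<noteq> 0"
        unfolding c_def d_def by (metis prod.inject)
    qed
    moreover have "commutativity_degree bracket \<le> zero_density (\<lambda>x y. (f (bracket x y), g (bracket x y)))"
    proof -
      interpret f: Vector_Spaces.linear scale "(*)" f by (rule f(1))
      interpret g: Vector_Spaces.linear scale "(*)" g by (rule g(1))
      have "finite {(x, y). (f (bracket x y), g (bracket x y)) = 0}"
        using finite_subset[OF subset_UNIV] fin finite_prod by blast
      then have "card {(x, y). bracket x y = 0} \<le> card {(x, y). (f (bracket x y), g (bracket x y)) = 0}"
        by (rule card_mono) (auto simp: zero_prod_def f.zero g.zero)
      then show ?thesis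
        by (simp add: commutativity_degree_def zero_density_def divide_right_mono)
    qed
    ultimately show ?thesis
      using assms(3,7) by simp
  qed
qed

end
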